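(* Fix $\Delta\in(0,1)$ and let $$h^\star_{\mathrm{dif},\Delta}(r)=\log\frac{f_{\mathrm{dif},\Delta}(r)}{f_{\mathrm{dif},0}(r)},\quad r\in[0,1],\qquad\text{where } f_{\mathrm{dif},\Delta}(r)=\frac{2}{1-\Delta}\max\Big\{1-\frac{r}{1-\Delta},0\Big\}.$$ Then $$\lim_{M\to\infty}\overline{R}_\Delta\big([h^\star_{\mathrm{dif},\Delta}]_{[-M,M]}\big)=\infty,$$ where $[x]_{[-M,M]}=\min\{\max\{x,-M\},M\}$ denotes clipping to $[-M,M]$.
   Context: Setting: inverse transform watermark. The vocabulary is $\mathcal{W}=\{1,\dots,|\mathcal{W}|\}$, $|\mathcal{W}|\ge2$; an NTP distribution is a probability vector $\boldsymbol{P}=(P_w)_{w\in\mathcal{W}}$ and $P_{(i)}$ is its $i$-th largest coordinate. Let $U\sim U(0,1)$ and let $\pi$ be an independent uniformly random permutation of $\mathcal{W}$. Under $H_0$ the token $w$ is independent of $(U,\pi)$; under $H_1$ with NTP distribution $\boldsymbol{P}$, $w=\pi^{-1}(F^{-1}(U;\pi))$ with $F^{-1}(U;\pi)=\min\{i:\sum_{w'}P_{w'}\mathbf{1}_{\{\pi(w')\le i\}}\ge U\}$. Let $\eta(i)=\frac{i-1}{|\mathcal{W}|-1}$ and $Y^{\mathrm{dif}}=|U-\eta(\pi(w))|$. $\mathbb{E}_0$ and $\mathbb{E}_{1,\boldsymbol{P}}$ denote expectations under $H_0$ and under $H_1$ with NTP distribution $\boldsymbol{P}$ (all depend on $|\mathcal{W}|$).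 For a class $\mathcal{P}$ of NTP distributions, $R_{\mathcal{P}}(h)=-\inf_{\theta\ge0}\sup_{\boldsymbol{P}\in\mathcal{P}}\big(\theta\,\mathbb{E}_0h(Y^{\mathrm{dif}})+\log\mathbb{E}_{1,\boldsymbol{P}}e^{-\theta h(Y^{\mathrm{dif}})}\big)$ (with $\sup\emptyset=-\infty$). Let $(\varepsilon_{|\mathcal{W}|})$ be a nonnegative sequence with $\log|\mathcal{W}|\cdot\varepsilon_{|\mathcal{W}|}\to0$ as $|\mathcal{W}|\to\infty$. The belief class is $\overline{\mathcal{P}}_\Delta=\{\boldsymbol{P}:P_{(1)}\le1-\Delta,\ P_{(2)}\le\varepsilon_{|\mathcal{W}|}\}$, and the limit efficiency is $\overline{R}_\Delta(h)=\liminf_{|\mathcal{W}|\to\infty}R_{\overline{\mathcal{P}}_\Delta}(h)$. Conventions: $\log0=-\infty$, and $h^\star_{\mathrm{dif},\Delta}(1)=-\infty$, so the clipped function equals $-M$ on $[1-\Delta,1]$. *)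

theory Defs
  imports "HOL-Probability.Probability" "HOL-Combinatorics.Permutations"
begin

text \<open>
  The vocabulary is \<open>{1..n}\<close> with \<open>n\<close> its size; next-token-prediction distributions
  are pmfs on \<open>nat\<close> supported in it.
\<close>

definition ntp :: "nat \<Rightarrow> nat pmf set" where
  "ntp n = {P. set_pmf P \<subseteq> {1..n}}"

text \<open>The \<open>i\<close>-th largest coordinate, for \<open>1 \<le> i \<le> n\<close>, counted with multiplicity.\<close>

definition nth_largest :: "nat \<Rightarrow> nat pmf \<Rightarrow> nat \<Rightarrow> real" where
  "nth_largest n P i = rev (sort (map (pmf P) [1..<Suc n])) ! (i - 1)"

text \<open>
  The law of the pair of pseudorandom variables \<open>(U, \<pi>)\<close>. The second factor lives on the finite
  set of permutations (rather than on all functions), so that every section-wise Borel function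
  of the pair is measurable for the product sigma-algebra.
\<close>

definition key_measure :: "nat \<Rightarrow> (real \<times> (nat \<Rightarrow> nat)) measure" where
  "key_measure n =
     uniform_measure lborel {0<..<1} \<Otimes>\<^sub>M uniform_count_measure {\<pi>. \<pi> permutes {1..n}}"

definition inv_cdf :: "nat \<Rightarrow> nat pmf \<Rightarrow> real \<Rightarrow> (nat \<Rightarrow> nat) \<Rightarrow> nat" where
  "inv_cdf n P u \<pi> =
     (LEAST i. i \<in> {1..n} \<and> (\<Sum>w\<in>{1..n}. pmf P w * (if \<pi> w \<le> i then 1 else 0)) \<ge> u)"

definition wm_token :: "nat \<Rightarrow> nat pmf \<Rightarrow> real \<Rightarrow> (nat \<Rightarrow> nat) \<Rightarrow> nat" where
  "wm_token n P u \<pi> = inv \<pi> (inv_cdf n P u \<pi>)"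

definition eta :: "nat \<Rightarrow> nat \<Rightarrow> real" where
  "eta n i = (real i - 1) / (real n - 1)"

definition Y_dif :: "nat \<Rightarrow> real \<Rightarrow> (nat \<Rightarrow> nat) \<Rightarrow> nat \<Rightarrow> real" where
  "Y_dif n u \<pi> w = \<bar>u - eta n (\<pi> w)\<bar>"

text \<open>
  Expectation of \<open>g(Y)\<close> under the null hypothesis: the token is independent of \<open>(U, \<pi>)\<close>. Its law
  is otherwise unspecified and enters as the parameter \<open>Q\<close>.
\<close>

definition E0 :: "nat \<Rightarrow> nat pmf \<Rightarrow> (real \<Rightarrow> real) \<Rightarrow> real" where
  "E0 n Q g = (LINT (w, (u, \<pi>)) | (measure_pmf Q \<Otimes>\<^sub>M key_measure n). g (Y_dif n u \<pi> w))"

definition E1 :: "nat \<Rightarrow> nat pmf \<Rightarrow> (real \<Rightarrow> real) \<Rightarrow> real" where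
  "E1 n P g = (LINT (u, \<pi>) | key_measure n. g (Y_dif n u \<pi> (wm_token n P u \<pi>)))"

text \<open>Logarithm of a nonnegative real with the convention \<open>log 0 = -\<infinity>\<close>.\<close>

definition elog :: "real \<Rightarrow> ereal" where
  "elog x = (if x \<le> 0 then -\<infinity> else ereal (ln x))"

text \<open>
  Efficiency rate of a score function \<open>h\<close> over a class \<open>C\<close>. The expectations are Bochner integrals,
  so this is meant for bounded Borel \<open>h\<close>. The supremum over an empty class is \<open>-\<infinity>\<close>.
\<close>

definition rate :: "nat \<Rightarrow> nat pmf \<Rightarrow> nat pmf set \<Rightarrow> (real \<Rightarrow> real) \<Rightarrow> ereal" where
  "rate n Q C h =
     - (INF \<theta>\<in>{0::real..}. SUP P\<in>C.
          ereal (\<theta> * E0 n Q h) + elog (E1 n P (\<lambda>r. exp (- \<theta> * h r))))"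

definition belief_class :: "(nat \<Rightarrow> real) \<Rightarrow> real \<Rightarrow> nat \<Rightarrow> nat pmf set" where
  "belief_class \<epsilon> \<Delta> n =
     {P \<in> ntp n. nth_largest n P 1 \<le> 1 - \<Delta> \<and> nth_largest n P 2 \<le> \<epsilon> n}"

definition limit_rate ::
  "(nat \<Rightarrow> real) \<Rightarrow> (nat \<Rightarrow> nat pmf) \<Rightarrow> real \<Rightarrow> (real \<Rightarrow> real) \<Rightarrow> ereal" where
  "limit_rate \<epsilon> Q \<Delta> h = liminf (\<lambda>n. rate n (Q n) (belief_class \<epsilon> \<Delta> n) h)"

definition f_dif :: "real \<Rightarrow> real \<Rightarrow> real" where
  "f_dif \<Delta> r = 2 / (1 - \<Delta>) * max (1 - r / (1 - \<Delta>)) 0"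

text \<open>At \<open>r = 1\<close> the quotient is \<open>0 / 0 = 0\<close>, which gives the intended value \<open>-\<infinity>\<close>.\<close>

definition h_star :: "real \<Rightarrow> real \<Rightarrow> ereal" where
  "h_star \<Delta> r = elog (f_dif \<Delta> r / f_dif 0 r)"

definition clip :: "real \<Rightarrow> ereal \<Rightarrow> real" where
  "clip M x = real_of_ereal (min (max x (ereal (- M))) (ereal M))"

end

theory Submission imports Defs begin

text \<open>
  Write \<open>h\<close> for the score clipped at level \<open>M\<close>, and choose \<open>\<theta> = L / M\<close>. Under \<open>H\<^sub>0\<close> the statistic falls
  into \<open>[1 - \<Delta>, 1]\<close>, where \<open>h = - M\<close>, with probability at least \<open>\<Delta>\<^sup>2 / 8\<close>, while \<open>h \<le> - ln (1 - \<Delta>)\<close>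
  everywhere; so \<open>\<theta> E\<^sub>0 h \<le> 1 - L \<Delta>\<^sup>2 / 8\<close> for large \<open>M\<close>. Under \<open>H\<^sub>1\<close> the statistic is at
  most \<open>1 - \<Delta> - \<delta>\<close>, where \<open>exp (- \<theta> h) \<le> \<delta> powr (- \<theta>) \<le> exp 1\<close>, except with a probability that
  is below \<open>exp (- L)\<close> for small \<open>\<delta>\<close> and large vocabularies, uniformly over the class; on the exceptional
  event \<open>exp (- \<theta> h) \<le> exp L\<close>. Thus the logarithm of \<open>E\<^sub>1 exp (- \<theta> h)\<close> is at most 2 and the rate is
  at least \<open>L \<Delta>\<^sup>2 / 8 - 3\<close>, with \<open>L\<close> arbitrary.

  The exceptional event is that the top token is ranked near one of the two ends, or that the mass of
  the other tokens is not spread evenly over the ranks. Rank indicators of distinct tokens are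
  negatively correlated, so the mass of the other tokens of rank at most \<open>m\<close> has variance at most their
  maximal probability; by monotonicity finitely many \<open>m\<close> suffice.
\<close>

section \<open>Random permutations\<close>

text \<open>Composing with a transposition shows that every position gives the same sum; added over
  all positions, each permutation contributes the full sum of \<open>g\<close>. So
  \<open>\<pi> w\<close> is uniform on \<open>S\<close>, with probabilities kept as counts out of
  the factorial.\<close>

lemma sum_permutations_marginal:
  fixes g :: "'a \<Rightarrow> real"
  assumes S: "finite S" and w: "w \<in> S"
  shows "real (card S) * (\<Sum>\<pi> | \<pi> permutes S. g (\<pi> w)) = fact (card S) * (\<Sum>a\<in>S. g a)"
proof -
  let ?A = "\<lambda>v. \<Sum>\<pi> | \<pi> permutes S. g (\<pi> v)"
  have "?A v = ?A w" if "v \<in> S" for v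
    by (subst sum_permutations_compose_right[OF permutes_swap_id[OF that w]]) simp
  then have "real (card S) * ?A w = (\<Sum>v\<in>S. ?A v)" by simp
  also have "\<dots> = (\<Sum>\<pi> | \<pi> permutes S. \<Sum>v\<in>S. g (\<pi> v))" by (rule sum.swap)
  also have "\<dots> = (\<Sum>\<pi> | \<pi> permutes S. \<Sum>a\<in>S. g a)"
  proof (rule sum.cong[OF refl])
    fix \<pi> assume "\<pi> \<in> {\<pi>. \<pi> permutes S}"
    then show "(\<Sum>v\<in>S. g (\<pi> v)) = (\<Sum>a\<in>S. g a)"
      using sum.permute[of \<pi> S g] by (simp add: o_def)
  qed
  also have "\<dots> = fact (card S) * (\<Sum>a\<in>S. g a)"
    by (simp add: card_permutations[OF refl S])
  finally show ?thesis .
qed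

text \<open>
  By symmetry the sum is the same for every \<open>w \<noteq> v\<close>, and together with the sum of squares at
  \<open>w = v\<close> these add up to zero.
\<close>

lemma sum_permutations_pair_nonpos:
  fixes g :: "'a \<Rightarrow> real"
  assumes S: "finite S" and v: "v \<in> S" and w: "w \<in> S" "v \<noteq> w" and g: "(\<Sum>a\<in>S. g a) = 0"
  shows "(\<Sum>\<pi> | \<pi> permutes S. g (\<pi> v) * g (\<pi> w)) \<le> 0"
proof -
  let ?B = "\<lambda>x. \<Sum>\<pi> | \<pi> permutes S. g (\<pi> v) * g (\<pi> x)"
  have eq: "?B x = ?B w" if "x \<in> S - {v}" for x
    using that v w
    by (subst sum_permutations_compose_right[OF permutes_swap_id[of x S w]])
      (auto simp: transpose_def)
  have "0 = (\<Sum>\<pi> | \<pi> permutes S. g (\<pi> v) * (\<Sum>x\<in>S. g (\<pi> x)))"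
    using g by (intro sum.neutral[symmetric]) (auto simp: sum.permute[of _ S g] o_def)
  also have "\<dots> = (\<Sum>x\<in>S. ?B x)"
    by (simp only: sum_distrib_left) (rule sum.swap)
  also have "\<dots> = ?B v + (\<Sum>x\<in>S - {v}. ?B x)" using S v by (rule sum.remove)
  also have "\<dots> = ?B v + real (card (S - {v})) * ?B w" using eq by simp
  finally have "real (card (S - {v})) * ?B w = - ?B v" by simp
  moreover have "0 \<le> ?B v" by (simp add: sum_nonneg)
  moreover have "0 < card (S - {v})" using S w by (auto simp: card_gt_0_iff)
  ultimately show ?thesis
    by (smt (verit) mult_pos_pos of_nat_0_less_iff)
qed

text \<open>After expanding the square, the off-diagonal terms are nonpositive, because the weights
  are nonnegative and distinct positions are negatively correlated. Only the diagonal is left, as in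
  the independent case.\<close>

lemma sum_permutations_second_moment:
  fixes c g :: "'a \<Rightarrow> real"
  assumes S: "finite S" and g: "(\<Sum>a\<in>S. g a) = 0" "\<And>a. a \<in> S \<Longrightarrow> \<bar>g a\<bar> \<le> 1"
    and T: "T \<subseteq> S" and c: "\<And>w. w \<in> T \<Longrightarrow> 0 \<le> c w"
  shows "(\<Sum>\<pi> | \<pi> permutes S. (\<Sum>w\<in>T. c w * g (\<pi> w))\<^sup>2) \<le> fact (card S) * (\<Sum>w\<in>T. (c w)\<^sup>2)"
proof -
  have T': "finite T" using S T finite_subset by blast
  have "(\<Sum>\<pi> | \<pi> permutes S. (\<Sum>w\<in>T. c w * g (\<pi> w))\<^sup>2)
      = (\<Sum>\<pi> | \<pi> permutes S. \<Sum>v\<in>T. \<Sum>w\<in>T. c v * c w * (g (\<pi> v) * g (\<pi> w)))"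
    by (simp add: power2_eq_square sum_product algebra_simps)
  also have "\<dots> = (\<Sum>v\<in>T. \<Sum>w\<in>T. c v * c w * (\<Sum>\<pi> | \<pi> permutes S. g (\<pi> v) * g (\<pi> w)))"
    by (subst sum.swap, rule sum.cong[OF refl], subst sum.swap) (simp add: sum_distrib_left)
  also have "\<dots> \<le> (\<Sum>v\<in>T. \<Sum>w\<in>T. if w = v then (c v)\<^sup>2 * fact (card S) else 0)"
  proof (intro sum_mono)
    fix v w assume vw: "v \<in> T" "w \<in> T"
    show "c v * c w * (\<Sum>\<pi> | \<pi> permutes S. g (\<pi> v) * g (\<pi> w))
        \<le> (if w = v then (c v)\<^sup>2 * fact (card S) else 0)"
    proof (cases "w = v")
      case True
      have "(\<Sum>\<pi> | \<pi> permutes S. g (\<pi> v) * g (\<pi> v)) \<le> (\<Sum>\<pi> | \<pi> permutes S. 1)"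
      proof (intro sum_mono)
        fix \<pi> assume "\<pi> \<in> {\<pi>. \<pi> permutes S}"
        then have "\<bar>g (\<pi> v)\<bar> \<le> 1" using vw T g(2) permutes_in_image by fastforce
        then show "g (\<pi> v) * g (\<pi> v) \<le> 1" by (metis abs_mult_self_eq abs_ge_zero mult_le_one)
      qed
      also have "\<dots> = fact (card S)" by (simp add: card_permutations[OF refl S])
      finally show ?thesis using True
        by (simp add: power2_eq_square mult_left_mono)
    next
      case False
      then have "(\<Sum>\<pi> | \<pi> permutes S. g (\<pi> v) * g (\<pi> w)) \<le> 0"
        using sum_permutations_pair_nonpos[OF S _ _ _ g(1), of v w] vw T by blast
      then show ?thesis using c[OF vw(1)] c[OF vw(2)] False by (simp add: mult_nonneg_nonpos)
    qed
  qed
  also have "\<dots> = fact (card S) * (\<Sum>w\<in>T. (c w)\<^sup>2)"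
    using T' by (simp add: sum_distrib_left mult.commute)
  finally show ?thesis .
qed

text \<open>As in the Glivenko-Cantelli argument, monotonicity squeezes \<open>F m\<close> between
  its values at neighbouring grid points, between which the linear term moves by at most
  \<open>q / n\<close>. The number of grid points does not grow with \<open>n\<close>, so a union
  bound over them is affordable.\<close>

lemma grid_deviation:
  fixes F :: "nat \<Rightarrow> real"
  assumes F: "mono F" and a: "0 \<le> a" "a \<le> 1" and n: "0 < n" and K: "0 < K"
    and q: "q = n div K + 1"
    and grid: "\<And>k. k \<le> K \<Longrightarrow> \<bar>F (min (k * q) n) - a * real (min (k * q) n) / real n\<bar> \<le> e"
    and m: "m \<le> n"
  shows "\<bar>F m - a * real m / real n\<bar> \<le> e + real q / real n"
proof -
  define k where "k = m div q"
  have q0: "0 < q" using q by simp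
  \<comment> \<open>The \<open>+ 1\<close> in \<open>q\<close> makes \<open>K\<close> steps reach
    past \<open>n\<close>, so both neighbours of \<open>m\<close> have index at most
    \<open>K\<close>.\<close>
  have "n < K * q" using q K
    by (simp add: algebra_simps) (metis add.commute mult.commute dividend_less_div_times)
  then have "k < K" using m q0 unfolding k_def by (metis div_less_iff_less_mult le_less_trans)
  then have k: "k \<le> K" "Suc k \<le> K" by auto
  have lo: "k * q \<le> m" unfolding k_def by simp
  have "m mod q < q" "m = k * q + m mod q" using q0 unfolding k_def by auto
  then have hi: "m < k * q + q" by linarith
  let ?m1 = "min (k * q) n" and ?m2 = "min (Suc k * q) n"
  have m12: "?m1 \<le> m" "m \<le> ?m2" using lo hi m by auto
  have r: "real m \<le> real ?m1 + real q" "real ?m2 \<le> real m + real q"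
    using lo hi m by (auto simp: min_def simp del: of_nat_mult simp flip: of_nat_add)
  have s: "a * x / real n \<le> a * y / real n + real q / real n" if "x \<le> y + real q" for x y
  proof -
    have "a * x \<le> a * (y + real q)" using that a by (intro mult_left_mono) auto
    also have "\<dots> \<le> a * y + real q" using a by (simp add: distrib_left mult_left_le_one_le)
    finally show ?thesis using n by (simp add: divide_right_mono flip: add_divide_distrib)
  qed
  have "F ?m1 \<le> F m" "F m \<le> F ?m2" using m12[THEN monoD[OF F]] by simp_all
  then show ?thesis using grid[OF k(1)] grid[OF k(2)] s[OF r(1)] s[OF r(2)] by linarith
qed

text \<open>Sorting the tokens by probability, instead of the probabilities alone, attaches a token
  to each order statistic. Ties are harmless: a token other than the first in the list sits at index
  1 or later.\<close>

lemma nth_largest_obtain: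
  assumes n: "2 \<le> n"
  obtains t where "t \<in> {1..n}" "pmf P t = nth_largest n P 1"
    "\<And>w. w \<in> {1..n} - {t} \<Longrightarrow> pmf P w \<le> nth_largest n P 2"
proof -
  let ?xs = "rev (sort_key (pmf P) [1..<Suc n])"
  have "sort (map (pmf P) [1..<Suc n]) = map (pmf P) (sort_key (pmf P) [1..<Suc n])"
    by (rule properties_for_sort) auto
  then have nl: "nth_largest n P i = map (pmf P) ?xs ! (i - 1)" for i
    by (simp only: nth_largest_def rev_map)
  have len: "length ?xs = n" by simp
  have set: "set ?xs = {1..n}" by auto
  have srt: "sorted (rev (map (pmf P) ?xs))" by (simp add: rev_map)
  show ?thesis
  proof
    show "?xs ! 0 \<in> {1..n}" using nth_mem[of 0 ?xs] n len set by (metis less_le_trans zero_less_numeral)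
    show "pmf P (?xs ! 0) = nth_largest n P 1" using n len by (simp add: nl)
    fix w assume w: "w \<in> {1..n} - {?xs ! 0}"
    then obtain k where k: "k < n" "?xs ! k = w" using set len by (metis DiffD1 in_set_conv_nth)
    then have "1 \<le> k" using w by (cases k) auto
    then show "pmf P w \<le> nth_largest n P 2"
      using sorted_rev_nth_mono[OF srt, of 1 k] k n len by (simp add: nl)
  qed
qed

section \<open>The watermark statistic on a good key\<close>

text \<open>The minimum exists because the distribution function reaches 1 at \<open>n\<close>. The
  strict bound at \<open>i - 1\<close> is minimality, except for \<open>i = 1\<close>, where the
  distribution function at 0 vanishes.\<close>

lemma inv_cdf_props:
  assumes n: "2 \<le> n" and P: "P \<in> ntp n" and \<pi>: "\<pi> permutes {1..n}" and u: "0 < u" "u < 1"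
  defines "S \<equiv> \<lambda>m. \<Sum>w\<in>{1..n}. pmf P w * (if \<pi> w \<le> m then 1 else 0)"
    and "i \<equiv> inv_cdf n P u \<pi>"
  shows "i \<in> {1..n}" "u \<le> S i" "S (i - 1) < u"
proof -
  have Sn: "S n = 1"
  proof -
    have "S n = (\<Sum>w\<in>{1..n}. pmf P w)"
      unfolding S_def using permutes_in_image[OF \<pi>] by (intro sum.cong) auto
    also have "\<dots> = 1" using P by (intro sum_pmf_eq_1) (auto simp: ntp_def)
    finally show ?thesis .
  qed
  have i: "i = (LEAST i. i \<in> {1..n} \<and> u \<le> S i)"
    by (simp add: i_def inv_cdf_def S_def)
  have ex: "n \<in> {1..n} \<and> u \<le> S n" using n u Sn by simp
  show *: "i \<in> {1..n}" "u \<le> S i"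
    unfolding i using LeastI[of "\<lambda>i. i \<in> {1..n} \<and> u \<le> S i", OF ex] by blast+
  show "S (i - 1) < u"
  proof (cases "i = 1")
    case True
    have "0 < \<pi> w" if "w \<in> {1..n}" for w using permutes_in_image[OF \<pi>, of w] that by simp
    then have "S 0 = 0" unfolding S_def by (intro sum.neutral) fastforce
    then show ?thesis using u True by simp
  next
    case False
    then have "i - 1 \<in> {1..n}" "i - 1 < i" using * by auto
    then show ?thesis
      using not_less_Least[of "i - 1" "\<lambda>i. i \<in> {1..n} \<and> u \<le> S i"] unfolding i[symmetric]
      by (auto simp: not_le)
  qed
qed

text \<open>The token \<open>t\<close> is meant to be the most likely one. It is split off because
  its mass need not be small, whereas the remaining mass concentrates.\<close>

definition rest_mass :: "nat \<Rightarrow> nat pmf \<Rightarrow> nat \<Rightarrow> (nat \<Rightarrow> nat) \<Rightarrow> nat \<Rightarrow> real" where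
  "rest_mass n P t \<pi> m = (\<Sum>w\<in>{1..n} - {t}. pmf P w * (if \<pi> w \<le> m then 1 else 0))"

text \<open>\<open>Y_dif\<close> normalises ranks by \<open>n - 1\<close>, the mass deviations by
  \<open>n\<close>; the conversion costs \<open>1 / n\<close>, both at \<open>i\<close> and at
  \<open>i - 1\<close>.\<close>

lemma eta_bounds:
  assumes "2 \<le> n" "i \<in> {1..n}"
  shows "eta n i \<le> real i / real n" "real i / real n \<le> eta n i + 1 / real n"
    "real (i - 1) / real n \<le> eta n i" "eta n i \<le> real (i - 1) / real n + 1 / real n"
    "0 \<le> eta n i" "eta n i \<le> 1"
proof -
  have i: "1 \<le> real i" "real i \<le> real n" "2 \<le> real n" "real (i - 1) = real i - 1"
    using assms by auto
  have 1: "(real i - 1) / (real n - 1) \<le> real i / real n"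
    using i by (simp add: field_simps)
  have 2: "(real i - 1) / real n \<le> (real i - 1) / (real n - 1)"
    using i by (intro divide_left_mono) auto
  show "eta n i \<le> real i / real n" "real i / real n \<le> eta n i + 1 / real n"
    "real (i - 1) / real n \<le> eta n i" "eta n i \<le> real (i - 1) / real n + 1 / real n"
    using 1 2 unfolding eta_def i(4) by (simp_all add: diff_divide_distrib)
  show "0 \<le> eta n i" "eta n i \<le> 1" using i unfolding eta_def by simp_all
qed

text \<open>
  The token has rank \<open>i\<close> when \<open>U\<close> lies between the values of the distribution function at \<open>i - 1\<close>
  and \<open>i\<close>, and there it is about \<open>(1 - p) \<eta>(i)\<close>, plus \<open>p\<close> if the top token \<open>t\<close> has rank at most \<open>i\<close>.
  Hence \<open>Y\<close> is close to \<open>p\<close> only if \<open>\<eta>(i)\<close> is close to 0 with \<open>\<pi> t \<le> i\<close>, or close to 1 with \<open>\<pi> t \<ge> i\<close>.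
\<close>

lemma Y_dif_less:
  assumes n: "2 \<le> n" and P: "P \<in> ntp n" and \<pi>: "\<pi> permutes {1..n}" and u: "0 < u" "u < 1"
    and t: "t \<in> {1..n}" and pa: "pmf P t \<le> a"
    and dev: "\<And>m. m \<le> n \<Longrightarrow> \<bar>rest_mass n P t \<pi> m - (1 - pmf P t) * real m / real n\<bar> \<le> E"
    and \<beta>: "\<beta> \<le> eta n (\<pi> t)" "eta n (\<pi> t) \<le> 1 - \<beta>" "0 \<le> \<beta>"
    and small: "\<delta> + E + 1 / real n < a * \<beta>"
  shows "Y_dif n u \<pi> (wm_token n P u \<pi>) < a - \<delta>"
proof -
  define p where "p = pmf P t"
  define i where "i = inv_cdf n P u \<pi>"
  define x where "x = eta n i"
  have p: "0 \<le> p" "p \<le> 1" "p \<le> a" unfolding p_def using pa by (auto simp: pmf_le_1)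
  have S: "(\<Sum>w\<in>{1..n}. pmf P w * (if \<pi> w \<le> m then 1 else 0))
      = p * (if \<pi> t \<le> m then 1 else 0) + rest_mass n P t \<pi> m" for m
    unfolding rest_mass_def p_def using t by (intro sum.remove) auto
  have i: "i \<in> {1..n}" "u \<le> p * (if \<pi> t \<le> i then 1 else 0) + rest_mass n P t \<pi> i"
    "p * (if \<pi> t \<le> i - 1 then 1 else 0) + rest_mass n P t \<pi> (i - 1) < u"
    using inv_cdf_props[OF n P \<pi> u] unfolding S i_def by blast+
  have \<pi>t: "\<pi> t \<in> {1..n}" using t permutes_in_image[OF \<pi>] by blast
  have "\<pi> (wm_token n P u \<pi>) = i"
    unfolding wm_token_def i_def[symmetric] using permutes_inverses(1)[OF \<pi>] .
  then have Y: "Y_dif n u \<pi> (wm_token n P u \<pi>) = \<bar>u - x\<bar>" by (simp add: Y_dif_def x_def)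
  have x: "x \<le> real i / real n" "real i / real n \<le> x + 1 / real n"
    "real (i - 1) / real n \<le> x" "x \<le> real (i - 1) / real n + 1 / real n" "0 \<le> x" "x \<le> 1"
    unfolding x_def by (rule eta_bounds[OF n i(1)])+
  have sc: "(1 - p) * y \<le> (1 - p) * z + 1 / real n" if "y \<le> z + 1 / real n" for y z
  proof -
    have "(1 - p) * y \<le> (1 - p) * (z + 1 / real n)" using that p by (intro mult_left_mono) auto
    also have "\<dots> \<le> (1 - p) * z + 1 / real n"
      using p by (simp add: distrib_left divide_right_mono)
    finally show ?thesis .
  qed
  have up: "rest_mass n P t \<pi> i \<le> (1 - p) * x + 1 / real n + E"
  proof -
    have "i \<le> n" using i(1) by auto
    from dev[OF this] sc[OF x(2)] show ?thesis
      unfolding p_def[symmetric] times_divide_eq_right[symmetric] by linarith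
  qed
  have lo: "(1 - p) * x - 1 / real n - E \<le> rest_mass n P t \<pi> (i - 1)"
  proof -
    have "i - 1 \<le> n" using i(1) by auto
    from dev[OF this] sc[OF x(4)] show ?thesis
      unfolding p_def[symmetric] times_divide_eq_right[symmetric] by linarith
  qed
  have a0: "0 \<le> a" using p by simp
  have \<beta>1: "\<beta> \<le> 1" using \<beta> by linarith
  have a\<beta>: "a * \<beta> \<le> a" using a0 \<beta>1 by (simp add: mult_left_le)
  have mono: "eta n j \<le> eta n k" if "j \<le> k" for j k
    using that n by (simp add: eta_def divide_right_mono)
  have px: "p * x \<le> a * x" "p * (1 - x) \<le> a * (1 - x)" using x p by (auto intro: mult_right_mono)
  \<comment> \<open>Here \<open>u\<close> is at most the distribution function at \<open>i\<close>.
    If that includes \<open>p\<close>, then \<open>u - x\<close> is at most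
    \<open>p * (1 - x)\<close> up to errors, and \<open>\<beta> \<le> x\<close> gains
    \<open>a * \<beta>\<close>; otherwise only errors remain.\<close>
  have "u - x < a - \<delta>"
  proof (cases "\<pi> t \<le> i")
    case True
    then have "\<beta> \<le> x" using mono[OF True] \<beta> by (simp add: x_def)
    then have "a * \<beta> \<le> a * x" using a0 by (rule mult_left_mono)
    moreover have "u - x \<le> p * (1 - x) + 1 / real n + E" using i(2) up True by (simp add: algebra_simps)
    ultimately show ?thesis using px small by (simp add: algebra_simps)
  next
    case False
    then have "u - x \<le> 1 / real n + E - p * x" using i(2) up by (simp add: algebra_simps)
    moreover have "0 \<le> p * x" using p x by simp
    ultimately show ?thesis using a\<beta> small by linarith
  qed
  \<comment> \<open>Now the value at \<open>i - 1\<close> bounds \<open>u\<close> from below, so the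
    cases split there. If \<open>t\<close> is not counted, its rank is at least \<open>i\<close>,
    whence \<open>x \<le> 1 - \<beta>\<close>.\<close>
  moreover have "x - u < a - \<delta>"
  proof (cases "\<pi> t \<le> i - 1")
    case True
    then have "x - u \<le> p * x - p + 1 / real n + E" using i(3) lo by (simp add: algebra_simps)
    moreover have "p * x \<le> p" using p x by (simp add: mult_left_le)
    ultimately show ?thesis using a\<beta> small by linarith
  next
    case False
    then have "i \<le> \<pi> t" using i(1) by auto
    then have "x \<le> 1 - \<beta>" using mono \<beta> unfolding x_def by (meson order_trans)
    then have "a * x \<le> a * (1 - \<beta>)" using a0 by (rule mult_left_mono)
    moreover have "x - u \<le> p * x + 1 / real n + E" using i(3) lo False by (simp add: algebra_simps)
    ultimately show ?thesis using px small by (simp add: algebra_simps)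
  qed
  ultimately show ?thesis unfolding Y by (simp add: abs_less_iff)
qed

section \<open>Expectations over the key\<close>

text \<open>Centring each rank indicator by its mean \<open>m / n\<close> turns the deviation into a
  weighted sum with weights \<open>pmf P w\<close>. The sum of squared weights is at most the
  largest weight times the total mass.\<close>

lemma rest_mass_second_moment:
  assumes n: "2 \<le> n" and P: "P \<in> ntp n" and t: "t \<in> {1..n}" and m: "m \<le> n"
    and small: "\<And>w. w \<in> {1..n} - {t} \<Longrightarrow> pmf P w \<le> \<epsilon>" and \<epsilon>: "0 \<le> \<epsilon>"
  shows "(\<Sum>\<pi> | \<pi> permutes {1..n}. (rest_mass n P t \<pi> m - (1 - pmf P t) * real m / real n)\<^sup>2)
    \<le> fact n * \<epsilon>"
proof -
  define g where "g a = (if a \<le> m then 1 else 0) - real m / real n" for a :: nat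
  have "(\<Sum>w\<in>{1..n}. pmf P w) = 1" using P by (intro sum_pmf_eq_1) (auto simp: ntp_def)
  then have rest: "(\<Sum>w\<in>{1..n} - {t}. pmf P w) = 1 - pmf P t"
    using t by (simp add: sum_diff1)
  have dev: "rest_mass n P t \<pi> m - (1 - pmf P t) * real m / real n
      = (\<Sum>w\<in>{1..n} - {t}. pmf P w * g (\<pi> w))" for \<pi>
    unfolding rest_mass_def g_def rest[symmetric]
    by (simp add: sum_distrib_right sum_divide_distrib right_diff_distrib sum_subtractf)
  have "{a \<in> {1..n}. a \<le> m} = {1..m}" using m by auto
  then have "(\<Sum>a\<in>{1..n}. if a \<le> m then 1 else 0) = real m"
    by (simp flip: sum.inter_filter)
  then have g0: "(\<Sum>a\<in>{1..n}. g a) = 0" using n by (simp add: g_def sum_subtractf)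
  have g1: "\<bar>g a\<bar> \<le> 1" for a using m n by (auto simp: g_def)
  have "(\<Sum>w\<in>{1..n} - {t}. (pmf P w)\<^sup>2) \<le> (\<Sum>w\<in>{1..n} - {t}. \<epsilon> * pmf P w)"
    using small by (intro sum_mono) (auto simp: power2_eq_square mult_right_mono)
  also have "\<dots> = \<epsilon> * (1 - pmf P t)" by (simp only: rest sum_distrib_left[symmetric])
  also have "\<dots> \<le> \<epsilon>" using \<epsilon> by (simp add: mult_left_le)
  finally have "fact n * (\<Sum>w\<in>{1..n} - {t}. (pmf P w)\<^sup>2) \<le> fact n * \<epsilon>" by simp
  moreover have "(\<Sum>\<pi> | \<pi> permutes {1..n}. (\<Sum>w\<in>{1..n} - {t}. pmf P w * g (\<pi> w))\<^sup>2)
      \<le> fact (card {1..n}) * (\<Sum>w\<in>{1..n} - {t}. (pmf P w)\<^sup>2)"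
    by (rule sum_permutations_second_moment) (use g0 g1 in auto)
  ultimately show ?thesis unfolding dev by (simp only: card_atLeastAtMost diff_Suc_1)
qed

lemma card_eta_le: "real (card {a \<in> {1..n}. real a - 1 \<le> x}) \<le> x + 1" if "0 \<le> x"
proof -
  have "a \<le> nat \<lfloor>x\<rfloor> + 1" if "real a - 1 \<le> x" "1 \<le> a" for a :: nat
    using that by linarith
  then have "card {a \<in> {1..n}. real a - 1 \<le> x} \<le> card {1..nat \<lfloor>x\<rfloor> + 1}"
    by (intro card_mono) auto
  then show ?thesis using \<open>0 \<le> x\<close> by simp linarith
qed

text \<open>These ranks form an interval ending at \<open>n\<close>. The upper bound serves the
  alternative, the lower bound the null hypothesis.\<close>

lemma card_eta_ge:
  assumes "0 \<le> x"
  shows "real (card {a \<in> {1..n}. real n - real a \<le> x}) \<le> x + 1"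
    and "x < real n \<Longrightarrow> x \<le> real (card {a \<in> {1..n}. real n - real a \<le> x})"
proof -
  have *: "{a \<in> {1..n}. real n - real a \<le> x} = {max 1 (n - nat \<lfloor>x\<rfloor>)..n}" for n :: nat
    using assms by (auto simp: max_def) linarith+
  show "real (card {a \<in> {1..n}. real n - real a \<le> x}) \<le> x + 1"
    unfolding * using assms by simp linarith
  show "x \<le> real (card {a \<in> {1..n}. real n - real a \<le> x})" if "x < real n"
    unfolding * using assms that by (simp add: max_def) linarith
qed

text \<open>The rank of \<open>t\<close> is uniform, and each end contains at most
  \<open>\<beta> * (n - 1) + 1\<close> ranks.\<close>

lemma position_extreme:
  assumes n: "2 \<le> n" and t: "t \<in> {1..n}" and \<beta>: "0 \<le> \<beta>"
  shows "(\<Sum>\<pi> | \<pi> permutes {1..n}. if eta n (\<pi> t) < \<beta> \<or> 1 - \<beta> < eta n (\<pi> t) then 1 else 0)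
    \<le> fact n * (2 * \<beta> + 2 / real n)"
proof -
  let ?b = "\<lambda>a. eta n a < \<beta> \<or> 1 - \<beta> < eta n a"
  let ?x = "\<beta> * (real n - 1)"
  have x: "0 \<le> ?x" using n \<beta> by simp
  have "{a \<in> {1..n}. ?b a} \<subseteq> {a \<in> {1..n}. real a - 1 \<le> ?x} \<union> {a \<in> {1..n}. real n - real a \<le> ?x}"
    using n by (auto simp: eta_def field_simps)
  then have "card {a \<in> {1..n}. ?b a}
      \<le> card {a \<in> {1..n}. real a - 1 \<le> ?x} + card {a \<in> {1..n}. real n - real a \<le> ?x}"
    by (intro order_trans[OF card_mono card_Un_le]) auto
  then have "real (card {a \<in> {1..n}. ?b a}) \<le> 2 * ?x + 2"
    using card_eta_le[OF x, of n] card_eta_ge(1)[OF x, of n] by linarith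
  also have "\<dots> \<le> real n * (2 * \<beta> + 2 / real n)" using n \<beta> by (simp add: algebra_simps)
  finally have c: "real (card {a \<in> {1..n}. ?b a}) \<le> real n * (2 * \<beta> + 2 / real n)" .
  have "real n * (\<Sum>\<pi> | \<pi> permutes {1..n}. if ?b (\<pi> t) then 1 else 0)
      = fact n * real (card {a \<in> {1..n}. ?b a})"
    using sum_permutations_marginal[of "{1..n}" t "\<lambda>a. if ?b a then 1 else 0"] t
    by (simp flip: sum.inter_filter)
  also have "\<dots> \<le> fact n * (real n * (2 * \<beta> + 2 / real n))" by (intro mult_left_mono c) simp
  finally have "real n * (\<Sum>\<pi> | \<pi> permutes {1..n}. if ?b (\<pi> t) then 1 else 0)
      \<le> real n * (fact n * (2 * \<beta> + 2 / real n))" by (simp only: mult_ac)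
  then show ?thesis using n by (simp only: mult_le_cancel_left_pos)
qed

section \<open>Integration against the law of the key\<close>

lemma pair_prob_space_key:
  "pair_prob_space (uniform_measure lborel {0<..<1::real}) (uniform_count_measure {\<pi>. \<pi> permutes {1..n::nat}})"
proof -
  interpret U: prob_space "uniform_measure lborel {0<..<1::real}"
    by (rule prob_space_uniform_measure) auto
  have "{\<pi>. \<pi> permutes {1..n}} \<noteq> {}" using permutes_id by blast
  then interpret Pi: prob_space "uniform_count_measure {\<pi>. \<pi> permutes {1..n}}"
    by (rule prob_space_uniform_count_measure[OF finite_permutations[OF finite_atLeastAtMost]])
  show ?thesis by unfold_locales
qed

lemma prob_space_key: "prob_space (key_measure n)"
proof -
  interpret pair_prob_space "uniform_measure lborel {0<..<1::real}"
    "uniform_count_measure {\<pi>. \<pi> permutes {1..n}}" by (rule pair_prob_space_key)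
  show ?thesis unfolding key_measure_def by unfold_locales
qed

text \<open>Both expectations are bounded through product functions of the key, for which Fubini
  separates the factors. There are finitely many permutations, so any \<open>G\<close> is measurable
  and bounded.\<close>

lemma integrable_key_product:
  fixes f :: "real \<Rightarrow> real" and G :: "(nat \<Rightarrow> nat) \<Rightarrow> real"
  assumes f[measurable]: "f \<in> borel_measurable borel" and fB: "\<And>u. \<bar>f u\<bar> \<le> B"
  shows "integrable (key_measure n) (\<lambda>(u, \<pi>). f u * G \<pi>)"
    and "(LINT (u, \<pi>)|key_measure n. f u * G \<pi>)
      = (LINT u|uniform_measure lborel {0<..<1}. f u) * ((\<Sum>\<pi> | \<pi> permutes {1..n}. G \<pi>) / fact n)"
proof -
  let ?U = "uniform_measure lborel {0<..<1::real}"
  let ?S = "{\<pi>. \<pi> permutes {1..n}}"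
  interpret pair_prob_space ?U "uniform_count_measure ?S" by (rule pair_prob_space_key)
  have fin: "finite ?S" by (simp add: finite_permutations)
  have [measurable]: "G \<in> borel_measurable (uniform_count_measure ?S)"
    by (simp add: measurable_def sets_uniform_count_measure space_uniform_count_measure)
  have "AE x in ?U \<Otimes>\<^sub>M uniform_count_measure ?S.
      norm (case x of (u, \<pi>) \<Rightarrow> f u * G \<pi>) \<le> B * (\<Sum>\<pi>\<in>?S. \<bar>G \<pi>\<bar>)"
  proof (rule AE_I2)
    fix x assume "x \<in> space (?U \<Otimes>\<^sub>M uniform_count_measure ?S)"
    then have "snd x \<in> ?S" by (auto simp: space_pair_measure space_uniform_count_measure)
    then have "\<bar>G (snd x)\<bar> \<le> (\<Sum>\<pi>\<in>?S. \<bar>G \<pi>\<bar>)" by (rule member_le_sum) (use fin in auto)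
    moreover have "\<bar>f (fst x)\<bar> \<le> B" by (rule fB)
    ultimately show "norm (case x of (u, \<pi>) \<Rightarrow> f u * G \<pi>) \<le> B * (\<Sum>\<pi>\<in>?S. \<bar>G \<pi>\<bar>)"
      by (auto simp: abs_mult split: prod.split intro!: mult_mono order_trans[OF abs_ge_zero fB])
  qed
  then show int: "integrable (key_measure n) (\<lambda>(u, \<pi>). f u * G \<pi>)"
    unfolding key_measure_def by (rule integrable_const_bound) measurable
  have "(LINT (u, \<pi>)|key_measure n. f u * G \<pi>)
      = (LINT u|?U. LINT \<pi>|uniform_count_measure ?S. f u * G \<pi>)"
    using integral_fst'[OF int[unfolded key_measure_def]] by (simp add: key_measure_def)
  also have "\<dots> = (LINT u|?U. f u) * ((\<Sum>\<pi>\<in>?S. G \<pi>) / fact n)"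
    by (simp add: integral_uniform_count_measure[OF fin] card_permutations[of "{1..n}" n]
        del: One_nat_def)
  finally show "(LINT (u, \<pi>)|key_measure n. f u * G \<pi>)
      = (LINT u|?U. f u) * ((\<Sum>\<pi>\<in>?S. G \<pi>) / fact n)" .
qed

lemma AE_key: "AE (u, \<pi>) in key_measure n. 0 < u \<and> u < 1 \<and> \<pi> permutes {1..n}"
proof -
  let ?U = "uniform_measure lborel {0<..<1::real}"
  let ?S = "{\<pi>. \<pi> permutes {1..n}}"
  interpret pair_prob_space ?U "uniform_count_measure ?S" by (rule pair_prob_space_key)
  have "AE u in ?U. 0 < u \<and> u < 1" by (rule AE_uniform_measureI) auto
  moreover have pm: "{x \<in> space (?U \<Otimes>\<^sub>M uniform_count_measure ?S). 0 < fst x \<and> fst x < 1}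
      \<in> sets (?U \<Otimes>\<^sub>M uniform_count_measure ?S)" by measurable
  ultimately have "AE x in ?U \<Otimes>\<^sub>M uniform_count_measure ?S. 0 < fst x \<and> fst x < 1"
    by (intro AE_pair_measure pm) simp
  then have "AE x in key_measure n. 0 < fst x \<and> fst x < 1" by (simp only: key_measure_def)
  moreover have "AE x in key_measure n. snd x permutes {1..n}"
    by (rule AE_I2) (auto simp: key_measure_def space_pair_measure space_uniform_count_measure)
  ultimately show ?thesis by eventually_elim auto
qed

text \<open>Nonnegativity of \<open>G\<close> matters because a nonintegrable function has Bochner
  integral 0: with it, the comparison holds without measurability of the watermarked token in the
  key.\<close>

lemma E1_le:
  assumes le: "\<And>u \<pi>. 0 < u \<Longrightarrow> u < 1 \<Longrightarrow> \<pi> permutes {1..n} \<Longrightarrow>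
      g (Y_dif n u \<pi> (wm_token n P u \<pi>)) \<le> G \<pi>"
    and G: "\<And>\<pi>. \<pi> permutes {1..n} \<Longrightarrow> 0 \<le> G \<pi>"
  shows "E1 n P g \<le> (\<Sum>\<pi> | \<pi> permutes {1..n}. G \<pi>) / fact n"
proof -
  interpret U: prob_space "uniform_measure lborel {0<..<1::real}"
    by (rule prob_space_uniform_measure) auto
  have "E1 n P g \<le> (LINT (u, \<pi>)|key_measure n. 1 * G \<pi>)"
    unfolding E1_def
  proof (rule integral_mono_AE')
    show "integrable (key_measure n) (\<lambda>(u, \<pi>). 1 * G \<pi>)"
      using integrable_key_product(1)[of "\<lambda>_. 1" 1] by simp
    show "AE x in key_measure n. (case x of (u, \<pi>) \<Rightarrow> g (Y_dif n u \<pi> (wm_token n P u \<pi>)))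
        \<le> (case x of (u, \<pi>) \<Rightarrow> 1 * G \<pi>)"
      using AE_key by eventually_elim (auto intro: le)
    show "AE x in key_measure n. 0 \<le> (case x of (u, \<pi>) \<Rightarrow> 1 * G \<pi>)"
      using AE_key by eventually_elim (auto intro: G)
  qed
  also have "\<dots> = (\<Sum>\<pi> | \<pi> permutes {1..n}. G \<pi>) / fact n"
    by (subst integrable_key_product(2)[of "\<lambda>_. 1" 1]) (auto simp: U.prob_space)
  finally show ?thesis .
qed

text \<open>If the rank of \<open>t\<close> is not extreme and all grid deviations are at most
  \<open>e\<close>, the statistic is below \<open>a - \<delta>\<close> and \<open>g\<close> is at
  most \<open>A\<close>. Otherwise \<open>g\<close> is at most \<open>B\<close>, and the probability
  of this is bounded by Chebyshev and a union bound.\<close>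

lemma E1_concentration:
  assumes n: "2 \<le> n" and P: "P \<in> ntp n" and t: "t \<in> {1..n}" and pa: "pmf P t \<le> a"
    and rest: "\<And>w. w \<in> {1..n} - {t} \<Longrightarrow> pmf P w \<le> \<epsilon>" and \<epsilon>: "0 \<le> \<epsilon>"
    and \<beta>: "0 \<le> \<beta>" and K: "0 < K" and e: "0 < e"
    and small: "\<delta> + (e + real (n div K + 1) / real n) + 1 / real n < a * \<beta>"
    and A: "0 \<le> A" "\<And>r. 0 \<le> r \<Longrightarrow> r < a - \<delta> \<Longrightarrow> g r \<le> A"
    and B: "0 \<le> B" "\<And>r. g r \<le> B"
  shows "E1 n P g \<le> A + B * (2 * \<beta> + 2 / real n + real (K + 1) * \<epsilon> / e\<^sup>2)"
proof -
  define m where "m k = min (k * (n div K + 1)) n" for k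
  define dev where "dev \<pi> j = rest_mass n P t \<pi> j - (1 - pmf P t) * real j / real n" for \<pi> j
  define X where "X \<pi> = (if eta n (\<pi> t) < \<beta> \<or> 1 - \<beta> < eta n (\<pi> t) then 1 else 0 :: real)" for \<pi>
  \<comment> \<open>Chebyshev before averaging: if a deviation exceeds \<open>e\<close>, its term in
    the sum exceeds 1, so the bracket dominates the indicator of the bad event.\<close>
  define G where "G \<pi> = A + B * (X \<pi> + (\<Sum>k\<le>K. (dev \<pi> (m k))\<^sup>2 / e\<^sup>2))" for \<pi>
  have G0: "0 \<le> G \<pi>" for \<pi>
    unfolding G_def X_def using A B by (auto intro!: add_nonneg_nonneg mult_nonneg_nonneg sum_nonneg)
  have gG: "g (Y_dif n u \<pi> (wm_token n P u \<pi>)) \<le> G \<pi>"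
    if u: "0 < u" "u < 1" and \<pi>: "\<pi> permutes {1..n}" for u \<pi>
  proof (cases "X \<pi> = 0 \<and> (\<forall>k\<le>K. \<bar>dev \<pi> (m k)\<bar> \<le> e)")
    case True
    then have eta: "\<beta> \<le> eta n (\<pi> t)" "eta n (\<pi> t) \<le> 1 - \<beta>"
      by (auto simp: X_def not_less split: if_splits)
    have "mono (rest_mass n P t \<pi>)"
      unfolding rest_mass_def by (intro monoI sum_mono) auto
    then have "\<bar>rest_mass n P t \<pi> j - (1 - pmf P t) * real j / real n\<bar>
        \<le> e + real (n div K + 1) / real n" if "j \<le> n" for j
      by (rule grid_deviation[where K = K])
        (use True n K that in \<open>auto simp: pmf_le_1 dev_def m_def\<close>)
    then have "Y_dif n u \<pi> (wm_token n P u \<pi>) < a - \<delta>"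
      by (rule Y_dif_less[OF n P \<pi> u t pa _ eta \<beta> small])
    moreover have "0 \<le> Y_dif n u \<pi> (wm_token n P u \<pi>)" by (simp add: Y_dif_def)
    ultimately have "g (Y_dif n u \<pi> (wm_token n P u \<pi>)) \<le> A" by (intro A)
    also have "A \<le> G \<pi>"
      unfolding G_def X_def using B by (auto intro!: add_nonneg_nonneg mult_nonneg_nonneg sum_nonneg)
    finally show ?thesis .
  next
    case False
    have "1 \<le> X \<pi> + (\<Sum>k\<le>K. (dev \<pi> (m k))\<^sup>2 / e\<^sup>2)"
    proof (cases "X \<pi> = 0")
      case True
      then obtain k where k: "k \<le> K" "e < \<bar>dev \<pi> (m k)\<bar>" using False by (auto simp: not_le)
      then have "e\<^sup>2 \<le> (dev \<pi> (m k))\<^sup>2" using e by (simp add: abs_le_square_iff[symmetric])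
      then have "1 \<le> (dev \<pi> (m k))\<^sup>2 / e\<^sup>2" using e by simp
      also have "\<dots> \<le> (\<Sum>k\<le>K. (dev \<pi> (m k))\<^sup>2 / e\<^sup>2)"
        using k by (intro member_le_sum[of k "{..K}"]) auto
      finally show ?thesis using True by simp
    next
      case False
      then have "X \<pi> = 1" by (auto simp: X_def split: if_splits)
      then show ?thesis by (simp add: sum_nonneg)
    qed
    then have "B \<le> B * (X \<pi> + (\<Sum>k\<le>K. (dev \<pi> (m k))\<^sup>2 / e\<^sup>2))"
      using B(1) by (simp add: mult_le_cancel_left1)
    then show ?thesis using A(1) B(2)[of "Y_dif n u \<pi> (wm_token n P u \<pi>)"] unfolding G_def by linarith
  qed
  let ?S = "{\<pi>. \<pi> permutes {1..n}}"
  have "(\<Sum>\<pi>\<in>?S. G \<pi>)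
      = fact n * A + B * ((\<Sum>\<pi>\<in>?S. X \<pi>) + (\<Sum>k\<le>K. (\<Sum>\<pi>\<in>?S. (dev \<pi> (m k))\<^sup>2) / e\<^sup>2))"
  proof -
    have "(\<Sum>\<pi>\<in>?S. \<Sum>k\<le>K. (dev \<pi> (m k))\<^sup>2 / e\<^sup>2) = (\<Sum>k\<le>K. (\<Sum>\<pi>\<in>?S. (dev \<pi> (m k))\<^sup>2) / e\<^sup>2)"
      by (subst sum.swap) (simp add: sum_divide_distrib)
    then show ?thesis
      by (simp add: G_def sum.distrib sum_distrib_left[symmetric] card_permutations[of "{1..n}" n]
          del: One_nat_def)
  qed
  also have "\<dots> \<le> fact n * A + B * (fact n * (2 * \<beta> + 2 / real n) + (\<Sum>k\<le>K. fact n * \<epsilon> / e\<^sup>2))"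
  proof (intro add_left_mono mult_left_mono add_mono sum_mono divide_right_mono)
    show "(\<Sum>\<pi>\<in>?S. X \<pi>) \<le> fact n * (2 * \<beta> + 2 / real n)"
      unfolding X_def by (rule position_extreme[OF n t \<beta>])
    show "(\<Sum>\<pi>\<in>?S. (dev \<pi> (m k))\<^sup>2) \<le> fact n * \<epsilon>" for k
      unfolding dev_def by (rule rest_mass_second_moment[OF n P t _ rest \<epsilon>]) (simp add: m_def)
  qed (use B in auto)
  also have "\<dots> = fact n * (A + B * (2 * \<beta> + 2 / real n + real (K + 1) * \<epsilon> / e\<^sup>2))"
    by (simp add: algebra_simps)
  finally have "(\<Sum>\<pi>\<in>?S. G \<pi>) / fact n \<le> A + B * (2 * \<beta> + 2 / real n + real (K + 1) * \<epsilon> / e\<^sup>2)"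
    by (simp add: divide_le_eq mult.commute)
  with E1_le[of n g P G, OF gG G0] show ?thesis by linarith
qed

text \<open>If \<open>u \<le> \<Delta> / 2\<close> and
  \<open>eta n (\<pi> w) \<ge> 1 - \<Delta> / 2\<close>, the statistic is at least
  \<open>1 - \<Delta>\<close> and the score is \<open>- M\<close>. These events are independent, of
  probability \<open>\<Delta> / 2\<close> and at least \<open>\<Delta> / 4\<close>, for each fixed
  token, so the bound survives averaging over \<open>Q\<close>.\<close>

lemma E0_le:
  fixes h :: "real \<Rightarrow> real"
  assumes n: "2 \<le> n" and Q: "set_pmf Q \<subseteq> {1..n}" and \<Delta>: "0 < \<Delta>" "\<Delta> < 1" and M: "0 \<le> M" and C: "0 \<le> C"
    and h[measurable]: "h \<in> borel_measurable borel" and hM: "\<And>r. \<bar>h r\<bar> \<le> M"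
    and hC: "\<And>r. 0 \<le> r \<Longrightarrow> r \<le> 1 \<Longrightarrow> h r \<le> C"
    and hm: "\<And>r. 1 - \<Delta> \<le> r \<Longrightarrow> r \<le> 1 \<Longrightarrow> h r = - M"
  shows "E0 n Q h \<le> C - M * (\<Delta>\<^sup>2 / 8)"
proof -
  let ?U = "uniform_measure lborel {0<..<1::real}"
  interpret K: prob_space "key_measure n" by (rule prob_space_key)
  interpret QK: pair_prob_space "measure_pmf Q" "key_measure n" by unfold_locales
  have meas: "(\<lambda>x. h (Y_dif n (fst x) (snd x) w)) \<in> borel_measurable (key_measure n)" for w
  proof -
    have [measurable]: "(\<lambda>\<pi>. eta n (\<pi> w)) \<in> borel_measurable (uniform_count_measure {\<pi>. \<pi> permutes {1..n}})"
      by (simp add: measurable_def sets_uniform_count_measure space_uniform_count_measure)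
    show ?thesis unfolding key_measure_def Y_dif_def by measurable
  qed
  let ?f = "\<lambda>(w, (u, \<pi>)). h (Y_dif n u \<pi> w)"
  have "?f \<in> borel_measurable (count_space UNIV \<Otimes>\<^sub>M key_measure n)"
    by (rule measurable_pair_measure_countable1) (use meas in \<open>auto simp: case_prod_unfold\<close>)
  then have fm: "?f \<in> borel_measurable (measure_pmf Q \<Otimes>\<^sub>M key_measure n)"
    by (simp cong: measurable_cong_sets sets_pair_measure_cong)
  have int: "integrable (measure_pmf Q \<Otimes>\<^sub>M key_measure n) ?f"
    by (rule QK.integrable_const_bound[OF AE_I2 fm, of M]) (auto simp: hM)
  have inner: "(LINT x|key_measure n. ?f (w, x)) \<le> C - M * (\<Delta>\<^sup>2 / 8)" if w: "w \<in> {1..n}" for w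
  proof -
    let ?a = "\<lambda>u::real. if u \<le> \<Delta> / 2 then 1 else 0 :: real"
    let ?b = "\<lambda>i. if 1 - \<Delta> / 2 \<le> eta n i then 1 else 0 :: real"
    have eta: "{i \<in> {1..n}. 1 - \<Delta> / 2 \<le> eta n i}
        = {i \<in> {1..n}. real n - real i \<le> \<Delta> / 2 * (real n - 1)}"
      using n by (auto simp: eta_def field_simps)
    have card: "\<Delta> / 2 * (real n - 1) \<le> real (card {i \<in> {1..n}. 1 - \<Delta> / 2 \<le> eta n i})"
    proof -
      have "\<Delta> / 2 * (real n - 1) \<le> 1 * (real n - 1)" using n \<Delta> by (intro mult_right_mono) auto
      then show ?thesis
        unfolding eta using n \<Delta> by (intro card_eta_ge(2)) auto
    qed
    \<comment> \<open>Half of \<open>\<Delta> / 2\<close> is given up because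
      \<open>(n - 1) / n\<close> is only known to be at least 1/2.\<close>
    have "real n * (fact n * (\<Delta> / 4)) \<le> fact n * (\<Delta> / 2 * (real n - 1))"
      using n \<Delta> by (simp add: field_simps)
    also have "\<dots> \<le> fact n * real (card {i \<in> {1..n}. 1 - \<Delta> / 2 \<le> eta n i})"
      using card by (intro mult_left_mono) auto
    also have "\<dots> = real n * (\<Sum>\<pi> | \<pi> permutes {1..n}. ?b (\<pi> w))"
      using sum_permutations_marginal[of "{1..n}" w ?b] w by (simp flip: sum.inter_filter)
    finally have b: "\<Delta> / 4 \<le> (\<Sum>\<pi> | \<pi> permutes {1..n}. ?b (\<pi> w)) / fact n"
      using n by (simp add: field_simps)
    have a: "(LINT u|?U. ?a u) = \<Delta> / 2"
    proof -
      have "(LINT u|?U. ?a u) = (LINT u|?U. indicator {..\<Delta> / 2} u)"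
        by (intro Bochner_Integration.integral_cong) (auto simp: indicator_def)
      also have "\<dots> = measure ?U {..\<Delta> / 2}" by simp
      also have "\<dots> = measure lborel ({0<..<1} \<inter> {..\<Delta> / 2}) / measure lborel {0<..<1::real}"
        by (rule measure_uniform_measure) auto
      also have "{0<..<1} \<inter> {..\<Delta> / 2} = {0<..\<Delta> / 2}" using \<Delta> by auto
      finally show ?thesis using \<Delta> by simp
    qed
    have iab: "integrable (key_measure n) (\<lambda>(u, \<pi>). ?a u * ?b (\<pi> w))"
      by (rule integrable_key_product(1)[of _ 1]) auto
    have "(LINT x|key_measure n. ?f (w, x))
        \<le> (LINT x|key_measure n. C - M * (case x of (u, \<pi>) \<Rightarrow> ?a u * ?b (\<pi> w)))"
    proof (rule integral_mono_AE)
      show "integrable (key_measure n) (\<lambda>x. ?f (w, x))"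
        by (rule K.integrable_const_bound[of _ M]) (use meas in \<open>auto simp: case_prod_unfold hM\<close>)
      show "integrable (key_measure n) (\<lambda>x. C - M * (case x of (u, \<pi>) \<Rightarrow> ?a u * ?b (\<pi> w)))"
        by (intro Bochner_Integration.integrable_diff integrable_mult_right iab) simp
      have le: "h (Y_dif n u \<pi> w) \<le> C - M * (?a u * ?b (\<pi> w))"
        if u: "0 < u" "u < 1" and \<pi>: "\<pi> permutes {1..n}" for u \<pi>
      proof -
        have "\<pi> w \<in> {1..n}" using w permutes_in_image[OF \<pi>] by blast
        from eta_bounds(5,6)[OF n this] have Y: "0 \<le> Y_dif n u \<pi> w" "Y_dif n u \<pi> w \<le> 1"
          using u by (auto simp: Y_dif_def)
        show ?thesis
        proof (cases "u \<le> \<Delta> / 2 \<and> 1 - \<Delta> / 2 \<le> eta n (\<pi> w)")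
          case True
          then have "1 - \<Delta> \<le> Y_dif n u \<pi> w" by (auto simp: Y_dif_def)
          from hm[OF this Y(2)] show ?thesis using True C by simp
        next
          case False
          then show ?thesis using hC[OF Y] by auto
        qed
      qed
      show "AE x in key_measure n. ?f (w, x) \<le> C - M * (case x of (u, \<pi>) \<Rightarrow> ?a u * ?b (\<pi> w))"
        using AE_key
      proof eventually_elim
        case (elim x)
        then show ?case using le[of "fst x" "snd x"] by (simp only: case_prod_unfold fst_conv snd_conv)
      qed
    qed
    also have "\<dots> = C - M * (LINT x|key_measure n. (case x of (u, \<pi>) \<Rightarrow> ?a u * ?b (\<pi> w)))"
      using Bochner_Integration.integral_diff[OF K.integrable_const[of C] integrable_mult_right[OF iab, of M]]
      by (simp only: integral_mult_right_zero lebesgue_integral_const K.prob_space scaleR_one)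
    also have "(LINT x|key_measure n. (case x of (u, \<pi>) \<Rightarrow> ?a u * ?b (\<pi> w)))
        = \<Delta> / 2 * ((\<Sum>\<pi> | \<pi> permutes {1..n}. ?b (\<pi> w)) / fact n)"
    proof -
      have "(LINT (u, \<pi>)|key_measure n. ?a u * ?b (\<pi> w))
          = (LINT u|?U. ?a u) * ((\<Sum>\<pi> | \<pi> permutes {1..n}. ?b (\<pi> w)) / fact n)"
        by (rule integrable_key_product(2)[of _ 1]) auto
      then show ?thesis unfolding a .
    qed
    also have "C - M * \<dots> \<le> C - M * (\<Delta> / 2 * (\<Delta> / 4))"
      using b M \<Delta> by (intro diff_left_mono mult_left_mono) auto
    finally show ?thesis by (simp add: power2_eq_square)
  qed
  have "E0 n Q h = (LINT w|measure_pmf Q. LINT x|key_measure n. ?f (w, x))"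
    unfolding E0_def by (rule QK.integral_fst'[OF int, symmetric])
  also have "\<dots> \<le> C - M * (\<Delta>\<^sup>2 / 8)"
    by (rule measure_pmf.integral_le_const[OF QK.integrable_fst'[OF int]])
      (use inner Q in \<open>auto simp: AE_measure_pmf_iff\<close>)
  finally show ?thesis .
qed

section \<open>The clipped score\<close>

lemma clip_ereal: "clip M (ereal y) = min (max y (- M)) M"
  by (simp add: clip_def min_def max_def)

lemma clip_minus_infinity: "0 \<le> M \<Longrightarrow> clip M (- \<infinity>) = - M"
  by (simp add: clip_def min_def)

lemma abs_clip_le: "0 \<le> M \<Longrightarrow> \<bar>clip M x\<bar> \<le> M"
  by (cases x) (auto simp: clip_def min_def max_def)

lemma borel_measurable_clip_h_star: "(\<lambda>r. clip M (h_star \<Delta> r)) \<in> borel_measurable borel"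
  unfolding clip_def h_star_def elog_def f_dif_def by measurable

lemma h_star_beyond: "1 - \<Delta> \<le> r \<Longrightarrow> \<Delta> < 1 \<Longrightarrow> h_star \<Delta> r = - \<infinity>"
  by (simp add: h_star_def elog_def f_dif_def max_def)

lemma h_star_below:
  assumes "0 < \<Delta>" "0 \<le> r" "r < 1 - \<Delta>"
  shows "h_star \<Delta> r = ereal (ln ((1 - \<Delta> - r) / ((1 - \<Delta>)\<^sup>2 * (1 - r))))"
proof -
  have "f_dif \<Delta> r / f_dif 0 r = (1 - \<Delta> - r) / ((1 - \<Delta>)\<^sup>2 * (1 - r))"
  proof -
    have "2 / q * (1 - r / q) / (2 * s) = (q - r) / (q\<^sup>2 * s)" if "0 < q" "0 < s" for q s
      using that by (simp add: field_simps power2_eq_square)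
    from this[of "1 - \<Delta>" "1 - r"] show ?thesis
      using assms by (simp add: f_dif_def max_def)
  qed
  moreover have "0 < (1 - \<Delta> - r) / ((1 - \<Delta>)\<^sup>2 * (1 - r))" using assms by simp
  ultimately show ?thesis by (simp add: h_star_def elog_def)
qed

text \<open>For \<open>r \<ge> 0\<close> the density ratio is largest at 0. The bound is
  nonnegative, so raising values to \<open>- M\<close> respects it, and it does not depend on
  \<open>M\<close>.\<close>

lemma clip_h_star_le:
  assumes "0 < \<Delta>" "\<Delta> < 1" "0 \<le> r" "0 \<le> M"
  shows "clip M (h_star \<Delta> r) \<le> - ln (1 - \<Delta>)"
proof -
  have C: "0 \<le> - ln (1 - \<Delta>)" using assms by simp
  show ?thesis
  proof (cases "r < 1 - \<Delta>")
    case True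
    have "(1 - \<Delta> - r) / ((1 - \<Delta>)\<^sup>2 * (1 - r)) \<le> inverse (1 - \<Delta>)"
    proof -
      have "1 - \<Delta> - r \<le> (1 - \<Delta>) * (1 - r)" using assms by (simp add: algebra_simps)
      then have "(1 - \<Delta> - r) / ((1 - \<Delta>)\<^sup>2 * (1 - r))
          \<le> (1 - \<Delta>) * (1 - r) / ((1 - \<Delta>)\<^sup>2 * (1 - r))"
        using assms True by (intro divide_right_mono) auto
      also have "\<dots> = inverse (1 - \<Delta>)" using assms True by (simp add: power2_eq_square inverse_eq_divide)
      finally show ?thesis .
    qed
    then have "ln ((1 - \<Delta> - r) / ((1 - \<Delta>)\<^sup>2 * (1 - r))) \<le> ln (inverse (1 - \<Delta>))"
      using assms True by (subst ln_le_cancel_iff) auto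
    moreover have "- M \<le> - ln (1 - \<Delta>)" using C assms by linarith
    ultimately show ?thesis
      using assms by (simp add: h_star_below[OF assms(1,3) True] clip_ereal ln_inverse min_le_iff_disj)
  next
    case False
    have "- M \<le> - ln (1 - \<Delta>)" using C assms by linarith
    then show ?thesis using False assms by (simp add: h_star_beyond clip_minus_infinity)
  qed
qed

text \<open>The denominator of the density ratio is at most 1 and the numerator exceeds
  \<open>\<delta>\<close>. Since \<open>\<delta> < 1\<close>, clipping at \<open>M\<close> does no
  harm.\<close>

lemma clip_h_star_ge:
  assumes "0 < \<Delta>" "0 \<le> r" "r < 1 - \<Delta> - \<delta>" "0 < \<delta>" "0 \<le> M"
  shows "ln \<delta> \<le> clip M (h_star \<Delta> r)"
proof -
  have r: "r < 1 - \<Delta>" using assms by linarith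
  have "(1 - \<Delta>)\<^sup>2 * (1 - r) \<le> 1" using assms by (intro mult_le_one power_le_one) auto
  then have "1 - \<Delta> - r \<le> (1 - \<Delta> - r) / ((1 - \<Delta>)\<^sup>2 * (1 - r))"
    using assms divide_left_mono[of "(1 - \<Delta>)\<^sup>2 * (1 - r)" 1 "1 - \<Delta> - r"] by simp
  then have "\<delta> \<le> (1 - \<Delta> - r) / ((1 - \<Delta>)\<^sup>2 * (1 - r))" using assms by linarith
  then have "ln \<delta> \<le> ln ((1 - \<Delta> - r) / ((1 - \<Delta>)\<^sup>2 * (1 - r)))"
    using assms by (subst ln_le_cancel_iff) auto
  moreover have "ln \<delta> \<le> M" using assms ln_le_zero_iff[of \<delta>] by linarith
  ultimately show ?thesis by (simp add: h_star_below[OF assms(1,2) r] clip_ereal le_max_iff_disj)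
qed

section \<open>Bounding the rate and unpacking the belief class\<close>

lemma elog_le: "x \<le> exp c \<Longrightarrow> elog x \<le> ereal c"
  unfolding elog_def using ln_mono[of x "exp c"] by auto

text \<open>The infimum is at most its value at a single \<open>\<theta>\<close>, so one choice that
  works for the whole class suffices. For an empty class the supremum is
  \<open>-\<infinity>\<close>, which is consistent with the bound.\<close>

lemma rate_geI:
  assumes "0 \<le> \<theta>"
    and "\<And>P. P \<in> C \<Longrightarrow> \<theta> * E0 n Q h + c \<le> - b"
    and "\<And>P. P \<in> C \<Longrightarrow> E1 n P (\<lambda>r. exp (- \<theta> * h r)) \<le> exp c"
  shows "ereal b \<le> rate n Q C h"
proof -
  let ?F = "\<lambda>\<theta>. SUP P\<in>C. ereal (\<theta> * E0 n Q h) + elog (E1 n P (\<lambda>r. exp (- \<theta> * h r)))"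
  have "?F \<theta> \<le> ereal (- b)"
  proof (rule SUP_least)
    fix P assume P: "P \<in> C"
    have "ereal (\<theta> * E0 n Q h) + elog (E1 n P (\<lambda>r. exp (- \<theta> * h r)))
        \<le> ereal (\<theta> * E0 n Q h) + ereal c"
      using elog_le[OF assms(3)[OF P]] by (rule add_left_mono)
    also have "\<dots> \<le> ereal (- b)" using assms(2)[OF P] by simp
    finally show "ereal (\<theta> * E0 n Q h) + elog (E1 n P (\<lambda>r. exp (- \<theta> * h r))) \<le> ereal (- b)" .
  qed
  moreover have "(INF \<theta>\<in>{0..}. ?F \<theta>) \<le> ?F \<theta>" using assms(1) by (intro INF_lower) simp
  ultimately have "(INF \<theta>\<in>{0..}. ?F \<theta>) \<le> ereal (- b)" by (rule order_trans[rotated])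
  then have "- ereal (- b) \<le> - (INF \<theta>\<in>{0..}. ?F \<theta>)" by (simp only: ereal_minus_le_minus)
  then show ?thesis unfolding rate_def by simp
qed

lemma belief_class_obtain:
  assumes "2 \<le> n" "P \<in> belief_class \<epsilon> \<Delta> n"
  obtains t where "t \<in> {1..n}" "pmf P t \<le> 1 - \<Delta>" "\<And>w. w \<in> {1..n} - {t} \<Longrightarrow> pmf P w \<le> \<epsilon> n"
proof -
  obtain t where "t \<in> {1..n}" "pmf P t = nth_largest n P 1"
    "\<And>w. w \<in> {1..n} - {t} \<Longrightarrow> pmf P w \<le> nth_largest n P 2"
    using nth_largest_obtain[OF assms(1)] by blast
  then show ?thesis using that assms(2) unfolding belief_class_def by fastforce
qed

text \<open>From \<open>n = 3\<close> on, \<open>ln n\<close> is at least 1, so the product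
  dominates \<open>\<epsilon> n\<close>.\<close>

lemma tendsto_zero_of_ln_mult:
  fixes \<epsilon> :: "nat \<Rightarrow> real"
  assumes "\<And>n. n \<ge> 2 \<Longrightarrow> 0 \<le> \<epsilon> n" "(\<lambda>n. ln (real n) * \<epsilon> n) \<longlonglongrightarrow> 0"
  shows "\<epsilon> \<longlonglongrightarrow> 0"
proof (rule Lim_null_comparison[OF _ assms(2)])
  show "\<forall>\<^sub>F n in sequentially. norm (\<epsilon> n) \<le> ln (real n) * \<epsilon> n"
    using eventually_ge_at_top[of 3]
  proof eventually_elim
    case (elim n)
    then have "exp 1 \<le> real n" using exp_le by linarith
    then have "1 \<le> ln (real n)" using elim by (simp add: ln_ge_iff)
    moreover have "0 \<le> \<epsilon> n" using assms(1) elim by simp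
    ultimately show ?case by (simp add: mult_le_cancel_right1)
  qed
qed

section \<open>The limit rate\<close>

lemma limit_rate_ge:
  assumes \<Delta>: "0 < \<Delta>" "\<Delta> < 1" and \<epsilon>: "\<And>n. n \<ge> 2 \<Longrightarrow> 0 \<le> \<epsilon> n" "\<epsilon> \<longlonglongrightarrow> 0"
    and Q: "\<And>n. n \<ge> 2 \<Longrightarrow> set_pmf (Q n) \<subseteq> {1..n}" and L: "0 \<le> L"
  shows "\<forall>\<^sub>F M in at_top. ereal (L * \<Delta>\<^sup>2 / 8 - 3) \<le> limit_rate \<epsilon> Q \<Delta> (\<lambda>r. clip M (h_star \<Delta> r))"
proof -
  \<comment> \<open>The budget for the bad event: \<open>2 * \<beta>\<close> uses a quarter of it,
    \<open>2 / n\<close> another quarter and the variance term one half.\<close>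
  define \<rho> where "\<rho> = exp (- L)"
  define \<beta> where "\<beta> = \<rho> / 8"
  \<comment> \<open>Serves as both the margin and the grid tolerance. With \<open>1 / K < d\<close>
    and \<open>2 / n < d\<close> the errors add up to less than \<open>4 * d\<close>, within the
    available \<open>8 * d\<close>.\<close>
  define d where "d = (1 - \<Delta>) * \<beta> / 8"
  define C where "C = - ln (1 - \<Delta>)"
  have \<rho>: "0 < \<rho>" and \<beta>: "0 < \<beta>" and d: "0 < d" "(1 - \<Delta>) * \<beta> = 8 * d" and C: "0 \<le> C"
    using \<Delta> by (auto simp: \<rho>_def \<beta>_def d_def C_def)
  obtain K where K: "0 < K" "1 / real K < d"
    using reals_Archimedean[OF d(1)] by (metis inverse_eq_divide zero_less_Suc)
  have "(\<lambda>n. real (K + 1) * \<epsilon> n / d\<^sup>2) \<longlonglongrightarrow> real (K + 1) * 0 / d\<^sup>2"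
    by (intro tendsto_intros \<epsilon>) (use d in auto)
  then have ev\<epsilon>: "\<forall>\<^sub>F n in sequentially. real (K + 1) * \<epsilon> n / d\<^sup>2 < \<rho> / 2"
    by (rule order_tendstoD(2)) (use \<rho> in simp)
  have "(\<lambda>n. 2 / real n) \<longlonglongrightarrow> 0" by (rule lim_const_over_n)
  then have evn: "\<forall>\<^sub>F n in sequentially. 2 / real n < min d (\<rho> / 4)"
    by (rule order_tendstoD(2)) (use d \<rho> in simp)
  \<comment> \<open>With \<open>\<theta> = L / M\<close>, the last two conditions on
    \<open>M\<close> say that \<open>\<theta> * C\<close> and \<open>- \<theta> * ln d\<close> are
    at most 1. They do not involve \<open>n\<close>, so \<open>M\<close> is fixed before the limit
    in \<open>n\<close>.\<close>
  have ev: "\<forall>\<^sub>F n in sequentially. ereal (L * \<Delta>\<^sup>2 / 8 - 3)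
      \<le> rate n (Q n) (belief_class \<epsilon> \<Delta> n) (\<lambda>r. clip M (h_star \<Delta> r))"
    if M: "1 \<le> M" "L * C \<le> M" "L * (- ln d) \<le> M" for M
    using ev\<epsilon> evn eventually_ge_at_top[of 2]
  proof eventually_elim
    case (elim n)
    define \<theta> where "\<theta> = L / M"
    define h where "h r = clip M (h_star \<Delta> r)" for r
    have \<theta>: "0 \<le> \<theta>" "\<theta> * M = L" using L M by (auto simp: \<theta>_def)
    have hM: "\<bar>h r\<bar> \<le> M" for r unfolding h_def using M by (intro abs_clip_le) simp
    have "E0 n (Q n) h \<le> C - M * (\<Delta>\<^sup>2 / 8)"
    proof (rule E0_le)
      show "h \<in> borel_measurable borel" unfolding h_def by (rule borel_measurable_clip_h_star)
      show "h r \<le> C" if "0 \<le> r" for r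
        using clip_h_star_le[OF \<Delta> that, of M] M by (simp add: h_def C_def)
      show "h r = - M" if "1 - \<Delta> \<le> r" for r
        using that \<Delta> M by (simp add: h_def h_star_beyond clip_minus_infinity)
    qed (use elim Q \<Delta> M C hM in auto)
    then have "\<theta> * E0 n (Q n) h \<le> \<theta> * (C - M * (\<Delta>\<^sup>2 / 8))" using \<theta> by (intro mult_left_mono)
    also have "\<dots> = L * C / M - L * \<Delta>\<^sup>2 / 8" using M by (simp add: \<theta>_def field_simps)
    also have "\<dots> \<le> 1 - L * \<Delta>\<^sup>2 / 8" using M by simp
    \<comment> \<open>The loss of 3 is 1 from \<open>\<theta> * C\<close> plus 2 from the logarithm
      of the expectation under the alternative.\<close>
    finally have e0: "\<theta> * E0 n (Q n) h + 2 \<le> - (L * \<Delta>\<^sup>2 / 8 - 3)" by simp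
    have e1: "E1 n P (\<lambda>r. exp (- \<theta> * h r)) \<le> exp 2" if P: "P \<in> belief_class \<epsilon> \<Delta> n" for P
    proof -
      obtain t where t: "t \<in> {1..n}" "pmf P t \<le> 1 - \<Delta>"
        "\<And>w. w \<in> {1..n} - {t} \<Longrightarrow> pmf P w \<le> \<epsilon> n"
        using belief_class_obtain[OF elim(3) P] by blast
      have q: "real (n div K + 1) / real n \<le> 1 / real K + 1 / real n"
      proof -
        have "real (n div K) \<le> real n / real K" by (rule of_nat_div_le_of_nat)
        then have "real (n div K) / real n \<le> real n / real K / real n" by (rule divide_right_mono) simp
        then show ?thesis using elim by (simp add: add_divide_distrib)
      qed
      have "E1 n P (\<lambda>r. exp (- \<theta> * h r))
          \<le> exp 1 + exp L * (2 * \<beta> + 2 / real n + real (K + 1) * \<epsilon> n / d\<^sup>2)"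
      proof (rule E1_concentration[OF elim(3) _ t \<epsilon>(1)[OF elim(3)] _ K(1) d(1), where \<delta> = d])
        show "P \<in> ntp n" using P by (simp add: belief_class_def)
        show "d + (d + real (n div K + 1) / real n) + 1 / real n < (1 - \<Delta>) * \<beta>"
          using q K(2) elim(2) d by simp
        show "exp (- \<theta> * h r) \<le> exp 1" if r: "0 \<le> r" "r < 1 - \<Delta> - d" for r
        proof -
          have "\<theta> * ln d \<le> \<theta> * h r"
            using clip_h_star_ge[OF \<Delta>(1) r d(1), of M] M \<theta> by (intro mult_left_mono) (auto simp: h_def)
          moreover have "L * (- ln d) / M \<le> 1" using M by (subst divide_le_eq_1_pos) auto
          ultimately show ?thesis by (simp add: \<theta>_def)
        qed
        show "exp (- \<theta> * h r) \<le> exp L" for r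
        proof -
          have "\<theta> * (- h r) \<le> \<theta> * M" using hM[of r] \<theta> by (intro mult_left_mono) auto
          then show ?thesis using \<theta> by simp
        qed
      qed (use \<beta> in auto)
      also have "\<dots> \<le> exp 1 + exp L * \<rho>"
        using elim(1,2) by (intro add_left_mono mult_left_mono) (auto simp: \<beta>_def)
      also have "\<dots> = exp 1 + 1" by (simp add: \<rho>_def flip: exp_add)
      also have "\<dots> \<le> exp 1 * exp (1::real)"
      proof -
        have "2 \<le> exp (1::real)" using exp_ge_add_one_self[of "1::real"] by simp
        then have "exp 1 * 2 \<le> exp 1 * exp (1::real)" by (intro mult_left_mono) auto
        then show ?thesis using \<open>2 \<le> exp (1::real)\<close> by linarith
      qed
      also have "\<dots> = exp 2" by (simp flip: exp_add)
      finally show ?thesis .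
    qed
    show ?case using rate_geI[OF \<theta>(1) e0 e1] unfolding h_def .
  qed
  show ?thesis
    using eventually_ge_at_top[of 1] eventually_ge_at_top[of "L * C"] eventually_ge_at_top[of "L * (- ln d)"]
  proof eventually_elim
    case (elim M)
    then show ?case unfolding limit_rate_def by (intro Liminf_bounded ev)
  qed
qed

theorem theorem4p2:
  fixes \<Delta> :: real and \<epsilon> :: "nat \<Rightarrow> real" and Q :: "nat \<Rightarrow> nat pmf"
  assumes "0 < \<Delta>" and "\<Delta> < 1"
    and "\<And>n. n \<ge> 2 \<Longrightarrow> 0 \<le> \<epsilon> n"
    and "(\<lambda>n. ln (real n) * \<epsilon> n) \<longlonglongrightarrow> 0"
    and "\<And>n. n \<ge> 2 \<Longrightarrow> set_pmf (Q n) \<subseteq> {1..n}"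
  shows "((\<lambda>M::real. limit_rate \<epsilon> Q \<Delta> (\<lambda>r. clip M (h_star \<Delta> r))) \<longlongrightarrow> \<infinity>) at_top"
  unfolding tendsto_PInfty
proof
  fix b :: real
  \<comment> \<open>Solves \<open>L * \<Delta>\<^sup>2 / 8 - 3 = \<bar>b\<bar> + 1\<close>, which
    exceeds \<open>b\<close>.\<close>
  define L where "L = 8 * (\<bar>b\<bar> + 4) / \<Delta>\<^sup>2"
  have L: "0 \<le> L" "L * \<Delta>\<^sup>2 / 8 - 3 = \<bar>b\<bar> + 1" using assms(1) by (auto simp: L_def)
  have "b < L * \<Delta>\<^sup>2 / 8 - 3" unfolding L by linarith
  moreover have "\<forall>\<^sub>F M in at_top. ereal (L * \<Delta>\<^sup>2 / 8 - 3) \<le> limit_rate \<epsilon> Q \<Delta> (\<lambda>r. clip M (h_star \<Delta> r))"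
    by (rule limit_rate_ge[OF assms(1,2,3) tendsto_zero_of_ln_mult[OF assms(3,4)] assms(5) L(1)])
  ultimately show "\<forall>\<^sub>F M in at_top. ereal b < limit_rate \<epsilon> Q \<Delta> (\<lambda>r. clip M (h_star \<Delta> r))"
    by (elim eventually_mono) (meson less_ereal.simps(1) less_le_trans)
qed

end
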